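(* $\operatorname{Cov}(\mathrm{Cont}(2^\omega))\geq\mathfrak d$, where $\mathfrak d$ is the dominating number.
   Context: $\operatorname{Cov}(\mathrm{Cont}(2^\omega))$ is the least cardinality of a family $\mathcal F$ of continuous functions $f:2^\omega\to2^\omega$ such that for every $(x,y)\in(2^\omega)^2$ there is $f\in\mathcal F$ with $f(x)=y$ or $f(y)=x$. $\mathfrak d$ is the least cardinality of a family of functions $\omega\to\omega$ such that every function $\omega\to\omega$ is eventually dominated by a member of the family. *)

theory Defs
  imports "HOL-Analysis.Function_Topology"
begin

unbundle cardinal_syntax

(* The choice only fixes a representative: up to =o the value does not depend on it,
   and it is meaningful whenever the class of sets is nonempty (see least_card_witness). *)
definition least_card :: "'a set set \<Rightarrow> 'a rel" where
  "least_card K = |SOME A. A \<in> K \<and> (\<forall>B\<in>K. |A| \<le>o |B| )|"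

lemma least_card_witness:
  assumes "K \<noteq> {}"
  shows "\<exists>A\<in>K. least_card K = |A| \<and> (\<forall>B\<in>K. |A| \<le>o |B| )"
proof -
  have "\<exists>r\<in>card_of ` K. \<forall>r'\<in>card_of ` K. r \<le>o r'"
    using assms by (intro exists_minim_Card_order) (auto simp: card_of_Card_order)
  then have "\<exists>A. A \<in> K \<and> (\<forall>B\<in>K. |A| \<le>o |B| )"
    by auto
  from someI_ex[OF this] show ?thesis
    unfolding least_card_def by blast
qed

(* The Cantor space 2^omega is the type nat => bool, whose topology instance is the
   product of the discrete topologies on bool. *)
definition cont_covering :: "((nat \<Rightarrow> bool) \<Rightarrow> (nat \<Rightarrow> bool)) set \<Rightarrow> bool" where
  "cont_covering F \<longleftrightarrow>
     (\<forall>f\<in>F. continuous_on UNIV f) \<and> (\<forall>x y. \<exists>f\<in>F. f x = y \<or> f y = x)"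

definition Cov_Cont :: "((nat \<Rightarrow> bool) \<Rightarrow> (nat \<Rightarrow> bool)) rel" where
  "Cov_Cont = least_card {F. cont_covering F}"

definition dominating :: "(nat \<Rightarrow> nat) set \<Rightarrow> bool" where
  "dominating D \<longleftrightarrow> (\<forall>g. \<exists>h\<in>D. \<forall>\<^sub>F n in sequentially. g n \<le> h n)"

definition dominating_number :: "(nat \<Rightarrow> nat) rel" where
  "dominating_number = least_card {D. dominating D}"

lemma cont_covering_exists: "cont_covering (range (\<lambda>y x. y))"
  by (auto simp: cont_covering_def)

lemma dominating_UNIV: "dominating UNIV"
  unfolding dominating_def
proof
  fix g :: "nat \<Rightarrow> nat"
  show "\<exists>h\<in>UNIV. \<forall>\<^sub>F n in sequentially. g n \<le> h n"
    by (rule bexI[of _ g]) auto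
qed

end

theory Submission
  imports Defs
begin

text \<open>
  Let \<open>F\<close> be a covering family, and let \<open>Q\<close> be the countable set of sequences with finitely many
  ones. If some \<open>x\<close> avoids all images \<open>f ` Q\<close>, then the compact sets
  \<open>f -` {x} \<union> ({f x} - Q)\<close> with \<open>f \<in> F\<close> cover \<open>- Q\<close>, a copy of the Baire space, and lie inside it.
  A compact subset of the Baire space is bounded by a single function, so these
  bounds dominate. If there is no such \<open>x\<close>, then \<open>F \<times> Q\<close> maps onto the Cantor space, so \<open>F\<close> has
  at least the cardinality of the continuum.
\<close>

lemma compact_UNIV_cantor: "compact (UNIV :: (nat \<Rightarrow> bool) set)"
proof -
  have "compact_space (product_topology (\<lambda>i::nat. euclidean :: bool topology) UNIV)"
    unfolding compact_space_product_topology by (simp add: compact_space_def finite_imp_compact)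
  then have "compactin (euclidean :: (nat \<Rightarrow> bool) topology) UNIV"
    unfolding euclidean_product_topology compact_space_def by simp
  then show ?thesis by simp
qed

lemma closed_singleton_cantor: "closed {x :: nat \<Rightarrow> bool}"
proof -
  have "{x} = (\<Inter>k. (\<lambda>y. y k) -` {x k})"
    by auto
  also have "closed \<dots>"
    by (intro closed_INT ballI closed_vimage closed_singleton continuous_on_product_coordinates)
  finally show ?thesis .
qed

text \<open>The count depends only on the coordinates below \<open>m\<close>, so the set is a union
  of cylinders, one for each large enough set \<open>A\<close> of positions required to carry a
  one.\<close>

lemma open_card_less_prefix:
  "open {y :: nat \<Rightarrow> bool. n < card {k. k < m \<and> y k}}" (is "open ?U")
proof -
  have "?U = (\<Union>A\<in>{A. A \<subseteq> {..<m} \<and> n < card A}. \<Inter>k\<in>A. {y. y k})" (is "_ = ?V")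
  proof (intro equalityI subsetI)
    fix y assume "y \<in> ?U"
    then show "y \<in> ?V"
      by (intro UN_I[of "{k. k < m \<and> y k}"]) auto
  next
    fix y assume "y \<in> ?V"
    then obtain A where A: "A \<subseteq> {..<m}" "n < card A" "\<forall>k\<in>A. y k" by auto
    then have "card A \<le> card {k. k < m \<and> y k}"
      by (intro card_mono) auto
    with A show "y \<in> ?U" by simp
  qed
  moreover have "open {y :: nat \<Rightarrow> bool. y k}" for k
  proof -
    have "open ((\<lambda>y :: nat \<Rightarrow> bool. y k) -` {True})"
      by (intro open_vimage open_discrete continuous_on_product_coordinates)
    then show ?thesis by (simp add: vimage_def)
  qed
  ultimately show ?thesis
    by (auto intro!: open_UN open_INT intro: finite_subset)
qed

text \<open>For fixed \<open>n\<close> the open sets \<open>?U m\<close> increase with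
  \<open>m\<close> and cover \<open>K\<close>, so a finite subcover collapses to a single
  \<open>m\<close>. In Baire space terms, the position of the one with index \<open>n\<close>,
  counted from 0, is bounded on a compact set.\<close>

lemma compact_infinite_ones_bound:
  fixes K :: "(nat \<Rightarrow> bool) set"
  assumes "compact K" and inf: "\<And>y. y \<in> K \<Longrightarrow> infinite {k. y k}"
  shows "\<exists>m. \<forall>y\<in>K. n < card {k. k < m \<and> y k}"
proof -
  let ?U = "\<lambda>m. {y :: nat \<Rightarrow> bool. n < card {k. k < m \<and> y k}}"
  have "K \<subseteq> (\<Union>m. ?U m)"
  proof
    fix y assume "y \<in> K"
    then obtain A where A: "A \<subseteq> {k. y k}" "finite A" "card A = Suc n"
      using inf infinite_arbitrarily_large by blast
    then obtain m where "A \<subseteq> {..<m}"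
      using finite_nat_iff_bounded by blast
    then have "card A \<le> card {k. k < m \<and> y k}"
      using A by (intro card_mono) auto
    with A show "y \<in> (\<Union>m. ?U m)" by (intro UN_I[of m]) auto
  qed
  then obtain M where M: "finite M" "K \<subseteq> (\<Union>m\<in>M. ?U m)"
    using compactE_image[OF \<open>compact K\<close>, of UNIV ?U] open_card_less_prefix by auto
  obtain b where b: "M \<subseteq> {..<b}"
    using M finite_nat_iff_bounded by blast
  have "n < card {k. k < b \<and> y k}" if y: "y \<in> K" for y
  proof -
    obtain m where m: "m \<in> M" "n < card {k. k < m \<and> y k}"
      using M y by auto
    then have "card {k. k < m \<and> y k} \<le> card {k. k < b \<and> y k}"
      using b by (intro card_mono) auto
    with m show ?thesis by simp
  qed
  then show ?thesis by blast
qed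

text \<open>A point with infinitely many ones encodes the increasing enumeration of their positions.
  Here \<open>b i n\<close> lies above the entry with index \<open>n\<close> of every enumeration
  coming from \<open>K i\<close>; the domination obtained holds at all \<open>n\<close>, not just
  eventually.\<close>

lemma dominating_if_compact_cover:
  fixes K :: "'i \<Rightarrow> (nat \<Rightarrow> bool) set"
  assumes cpt: "\<And>i. i \<in> I \<Longrightarrow> compact (K i)"
    and inf: "\<And>i y. i \<in> I \<Longrightarrow> y \<in> K i \<Longrightarrow> infinite {k. y k}"
    and cover: "\<And>y. infinite {k. y k} \<Longrightarrow> \<exists>i\<in>I. y \<in> K i"
  shows "\<exists>b. dominating (b ` I)"
proof -
  have "\<forall>i\<in>I. \<exists>b. \<forall>n. \<forall>y\<in>K i. n < card {k. k < b n \<and> y k}"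
  proof
    fix i assume "i \<in> I"
    then have "\<forall>n. \<exists>m. \<forall>y\<in>K i. n < card {k. k < m \<and> y k}"
      using compact_infinite_ones_bound cpt inf by blast
    then show "\<exists>b. \<forall>n. \<forall>y\<in>K i. n < card {k. k < b n \<and> y k}"
      by (rule choice)
  qed
  then obtain b where b: "\<forall>i\<in>I. \<forall>n. \<forall>y\<in>K i. n < card {k. k < b i n \<and> y k}"
    by (rule bchoice[THEN exE]) blast
  have "\<exists>i\<in>I. \<forall>n. g n \<le> b i n" for g
  proof -
    \<comment> \<open>A strictly increasing majorant of \<open>g\<close>: the \<open>Suc\<close>
      keeps it strict where \<open>g\<close> vanishes. It enumerates the ones of the point to be
      covered.\<close>
    define a where "a n = (\<Sum>i\<le>n. Suc (g i))" for n
    have a: "strict_mono a"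
      by (auto simp: strict_mono_Suc_iff a_def)
    have g: "g n \<le> a n" for n
      unfolding a_def by (cases n) simp_all
    have "infinite {k. k \<in> range a}"
      using a by (simp add: range_inj_infinite strict_mono_imp_inj_on)
    from cover[OF this] obtain i where i: "i \<in> I" "(\<lambda>k. k \<in> range a) \<in> K i" by blast
    have "g n \<le> b i n" for n
    proof (rule ccontr)
      assume "\<not> g n \<le> b i n"
      with g[of n] have "b i n \<le> a n" by simp
      \<comment> \<open>By strict monotonicity only \<open>a 0\<close> up to
        \<open>a (n - 1)\<close> lie below \<open>a n\<close>, at most \<open>n\<close> ones where
        \<open>b i n\<close> promises more than \<open>n\<close>.\<close>
      then have "{k. k < b i n \<and> k \<in> range a} \<subseteq> a ` {..<n}"
        using a by (force simp: strict_mono_less dest: less_le_trans)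
      then have "card {k. k < b i n \<and> k \<in> range a} \<le> card (a ` {..<n})"
        by (intro card_mono) auto
      also have "\<dots> \<le> n"
        using card_image_le[of "{..<n}" a] by simp
      finally have "card {k. k < b i n \<and> k \<in> range a} \<le> n" .
      moreover have "n < card {k. k < b i n \<and> k \<in> range a}"
        using bspec[OF spec[OF bspec[OF b i(1)]] i(2)] .
      ultimately show False by simp
    qed
    with i show ?thesis by blast
  qed
  then have "dominating (b ` I)"
    unfolding dominating_def by (simp add: Bex_def) (meson always_eventually)
  then show ?thesis by blast
qed

text \<open>A function is coded by the characteristic function of its graph under
  \<open>prod_encode\<close>.\<close>

lemma card_of_baire_le_cantor: "|UNIV :: (nat \<Rightarrow> nat) set| \<le>o |UNIV :: (nat \<Rightarrow> bool) set|"
proof -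
  have "inj (\<lambda>(g :: nat \<Rightarrow> nat) k. \<exists>n. k = prod_encode (n, g n))"
  proof (rule injI)
    fix g h :: "nat \<Rightarrow> nat"
    assume eq: "(\<lambda>k. \<exists>n. k = prod_encode (n, g n)) = (\<lambda>k. \<exists>n. k = prod_encode (n, h n))"
    show "g = h"
    proof
      fix n
      from fun_cong[OF eq, of "prod_encode (n, g n)"] show "g n = h n"
        by (auto simp: prod_encode_eq)
    qed
  qed
  then show ?thesis
    by (intro card_of_ordLeqI) auto
qed

lemma uncountable_cantor: "uncountable (UNIV :: (nat \<Rightarrow> bool) set)"
proof
  assume "countable (UNIV :: (nat \<Rightarrow> bool) set)"
  then obtain e :: "nat \<Rightarrow> nat \<Rightarrow> bool" where "range e = UNIV"
    using uncountable_def[of "UNIV :: (nat \<Rightarrow> bool) set"] by auto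
  then obtain n where "e n = (\<lambda>k. \<not> e k k)"
    by (metis UNIV_I imageE)
  then show False by metis
qed

text \<open>A finite \<open>I\<close> would make \<open>A\<close> countable. For infinite
  \<open>I\<close>, a union of \<open>I\<close>-many countable sets has at most the cardinality of
  \<open>I\<close>.\<close>

lemma card_of_le_if_covered_by_countable:
  assumes "uncountable A" and "A \<subseteq> (\<Union>i\<in>I. C i)" and "\<And>i. i \<in> I \<Longrightarrow> countable (C i)"
  shows "|A| \<le>o |I|"
proof -
  have inf: "infinite I"
    using assms by (meson countable_UN countable_finite countable_subset)
  have "|C i| \<le>o |I|" if "i \<in> I" for i
  proof -
    have "|C i| \<le>o |UNIV :: nat set|"
      using assms(3)[OF that] unfolding countable_def
      by (blast intro: card_of_ordLeqI)
    also have "|UNIV :: nat set| \<le>o |I|"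
      using inf by (simp add: infinite_iff_card_of_nat)
    finally show ?thesis .
  qed
  then have "|\<Union>i\<in>I. C i| \<le>o |I|"
    using inf by (intro card_of_UNION_ordLeq_infinite) (auto intro: ordLeq_refl card_of_Card_order)
  with card_of_mono1[OF assms(2)] show ?thesis
    by (rule ordLeq_transitive)
qed

lemma cont_covering_imp_dominating:
  assumes "cont_covering F"
  shows "\<exists>D. dominating D \<and> |D| \<le>o |F|"
proof -
  define Q :: "(nat \<Rightarrow> bool) set" where "Q = {y. finite {k. y k}}"
  have cont: "continuous_on UNIV f" if "f \<in> F" for f
    using assms that by (simp add: cont_covering_def)
  have cover: "\<exists>f\<in>F. f x = y \<or> f y = x" for x y
    using assms by (simp add: cont_covering_def)
  show ?thesis
  proof (cases "\<exists>x. \<forall>f\<in>F. x \<notin> f ` Q")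
    case True
    then obtain x where x: "\<And>f. f \<in> F \<Longrightarrow> x \<notin> f ` Q" by blast
    \<comment> \<open>The two parts collect the \<open>y\<close> with \<open>f y = x\<close> and
      with \<open>y = f x\<close>. The first avoids \<open>Q\<close> by the choice of
      \<open>x\<close>; removing \<open>Q\<close> from the second leaves a finite set, so
      compactness survives.\<close>
    define K where "K f = f -` {x} \<union> ({f x} - Q)" for f
    have "\<exists>b. dominating (b ` F)"
    proof (rule dominating_if_compact_cover)
      fix f assume f: "f \<in> F"
      have "closed (f -` {x})"
        by (intro closed_vimage closed_singleton_cantor cont f)
      then have "compact (UNIV \<inter> f -` {x})"
        by (rule compact_Int_closed[OF compact_UNIV_cantor])
      then show "compact (K f)"
        unfolding K_def by (auto intro: compact_Un finite_imp_compact)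
      show "infinite {k. y k}" if "y \<in> K f" for y
        using that x[OF f] by (auto simp: K_def Q_def)
    next
      fix y :: "nat \<Rightarrow> bool" assume "infinite {k. y k}"
      with cover[of x y] show "\<exists>f\<in>F. y \<in> K f"
        by (auto simp: K_def Q_def)
    qed
    then show ?thesis using card_of_image by blast
  next
    case False
    have "Q = (\<lambda>A k. k \<in> A) ` {A. finite A}"
      by (force simp: Q_def)
    then have "countable Q"
      by (simp add: countable_Collect_finite)
    \<comment> \<open>Now every point lies in some \<open>f\<close> applied to \<open>Q\<close>, a
      countable image. Hence \<open>F\<close> is at least as large as the family of all functions,
      which is dominating.\<close>
    with False have "|UNIV :: (nat \<Rightarrow> bool) set| \<le>o |F|"
      by (intro card_of_le_if_covered_by_countable[OF uncountable_cantor, where C = "\<lambda>f. f ` Q"]) auto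
    with card_of_baire_le_cantor have "|UNIV :: (nat \<Rightarrow> nat) set| \<le>o |F|"
      by (rule ordLeq_transitive)
    then show ?thesis using dominating_UNIV by blast
  qed
qed

theorem mainTheorem5:
  shows "dominating_number \<le>o Cov_Cont"
proof -
  obtain F where F: "cont_covering F" "Cov_Cont = |F|"
    using least_card_witness[of "{F. cont_covering F}"] cont_covering_exists
    unfolding Cov_Cont_def by auto
  obtain D where D: "dominating D" "|D| \<le>o |F|"
    using cont_covering_imp_dominating[OF F(1)] by blast
  have "dominating_number \<le>o |D|"
    using least_card_witness[of "{D. dominating D}"] D(1)
    unfolding dominating_number_def by fastforce
  with D F show ?thesis
    using ordLeq_transitive by metis
qed

end
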